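(* Let $(X,\mathcal{S})$ be an $S$-metric space, let $T:X\to X$ be a self-mapping, and let $\rho=\inf\{\mathcal{S}(Tx,Tx,x):Tx\ne x,\ x\in X\}$. If $T$ is an $\mathcal{S}$-Zamfirescu type $x_0$-mapping with $x_0\in X$ and the condition $$\mathcal{S}(Tx,Tx,x_0)\le\rho$$ holds for each $x\in D^S_{x_0,\rho}$, then $D^S_{x_0,\rho}$ is a fixed disc of $T$, that is, $D^S_{x_0,\rho}\subset Fix(T)$.
   Context: An $S$-metric on a nonempty set $X$ is a function $\mathcal{S}:X\times X\times X\to[0,\infty)$ such that for all $x,y,z,w\in X$: (S1) $\mathcal{S}(x,y,z)=0$ if and only if $x=y=z$; (S2) $\mathcal{S}(x,y,z)\le\mathcal{S}(x,x,w)+\mathcal{S}(y,y,w)+\mathcal{S}(z,z,w)$. The pair $(X,\mathcal{S})$ is then an $S$-metric space. For $x_0\in X$ and $r\in[0,\infty)$ the disc is $D^S_{x_0,r}=\{x\in X:\mathcal{S}(x,x,x_0)\le r\}$. $Fix(T)=\{x\in X:Tx=x\}$; the disc $D^S_{x_0,r}$ is a fixed disc of $T$ if $Tx=x$ for all $x\in D^S_{x_0,r}$. A self-mapping $T$ is an $\mathcal{S}$-Zamfirescu type $x_0$-mapping (with $x_0\in X$) if there exist $a,b\in[0,1)$ such that for all $x\in X$: $\mathcal{S}(Tx,Tx,x)>0$ implies $$\mathcal{S}(Tx,Tx,x)\le\max\left\{a\,\mathcal{S}(x,x,x_0),\ \tfrac{b}{2}\left[\mathcal{S}(Tx_0,Tx_0,x)+\mathcal{S}(Tx,Tx,x_0)\right]\right\}.$$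 *)

theory Defs
  imports Complex_Main "HOL-Library.FuncSet"
begin

text \<open>Following the locale \<open>Metric_space\<close> in HOL-Analysis, the space is a carrier set in an ambient type, and
  the function is only constrained on that carrier.\<close>

locale S_metric_space =
  fixes X :: "'a set" and S :: "'a \<Rightarrow> 'a \<Rightarrow> 'a \<Rightarrow> real"
  assumes nonempty: "X \<noteq> {}"
    and nonneg: "\<lbrakk>x \<in> X; y \<in> X; z \<in> X\<rbrakk> \<Longrightarrow> 0 \<le> S x y z"
    and eq_zero_iff: "\<lbrakk>x \<in> X; y \<in> X; z \<in> X\<rbrakk> \<Longrightarrow> S x y z = 0 \<longleftrightarrow> x = y \<and> y = z"
    and triangle: "\<lbrakk>x \<in> X; y \<in> X; z \<in> X; w \<in> X\<rbrakk>
      \<Longrightarrow> S x y z \<le> S x x w + S y y w + S z z w"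

definition S_disc :: "'a set \<Rightarrow> ('a \<Rightarrow> 'a \<Rightarrow> 'a \<Rightarrow> real) \<Rightarrow> 'a \<Rightarrow> real \<Rightarrow> 'a set" where
  "S_disc X S x0 r = {x \<in> X. S x x x0 \<le> r}"

definition Fix :: "'a set \<Rightarrow> ('a \<Rightarrow> 'a) \<Rightarrow> 'a set" where
  "Fix X T = {x \<in> X. T x = x}"

definition fixed_disc ::
  "'a set \<Rightarrow> ('a \<Rightarrow> 'a \<Rightarrow> 'a \<Rightarrow> real) \<Rightarrow> ('a \<Rightarrow> 'a) \<Rightarrow> 'a \<Rightarrow> real \<Rightarrow> bool" where
  "fixed_disc X S T x0 r \<longleftrightarrow> (\<forall>x \<in> S_disc X S x0 r. T x = x)"

definition S_Zamfirescu_type ::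
  "'a set \<Rightarrow> ('a \<Rightarrow> 'a \<Rightarrow> 'a \<Rightarrow> real) \<Rightarrow> ('a \<Rightarrow> 'a) \<Rightarrow> 'a \<Rightarrow> bool" where
  "S_Zamfirescu_type X S T x0 \<longleftrightarrow>
     (\<exists>a \<in> {0..<1}. \<exists>b \<in> {0..<1}. \<forall>x \<in> X. S (T x) (T x) x > 0 \<longrightarrow>
        S (T x) (T x) x \<le> max (a * S x x x0) (b / 2 * (S (T x0) (T x0) x + S (T x) (T x) x0)))"

text \<open>If \<open>T\<close> is the identity on \<open>X\<close>, this is the infimum of the empty set, for which
  \<^typ>\<open>real\<close> has no meaningful value.\<close>

definition S_displacement_inf ::
  "'a set \<Rightarrow> ('a \<Rightarrow> 'a \<Rightarrow> 'a \<Rightarrow> real) \<Rightarrow> ('a \<Rightarrow> 'a) \<Rightarrow> real" where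
  "S_displacement_inf X S T = Inf {S (T x) (T x) x | x. T x \<noteq> x \<and> x \<in> X}"

end

theory Submission
  imports Defs
begin

text \<open>The Zamfirescu condition at \<open>x0\<close> itself bounds the displacement of \<open>x0\<close> by \<open>b < 1\<close> times that
  displacement, so \<open>x0\<close> is a fixed point. For a point \<open>x\<close> of the disc, both quantities \<open>S x x x0\<close> and
  \<open>(S x0 x0 x + S (T x) (T x) x0) / 2\<close> are then at most \<open>\<rho>\<close>, where the second bound uses the symmetry
  \<open>S x0 x0 x = S x x x0\<close> and the assumption on \<open>T x\<close>. If \<open>T\<close> moved \<open>x\<close>, its displacement would therefore
  be at most \<open>max a b * \<rho>\<close>. But \<open>\<rho>\<close> is a lower bound for all positive displacements, and a positive
  number cannot be at most \<open>max a b < 1\<close> times itself.\<close>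

context S_metric_space
begin

text \<open>Taking \<open>w = x\<close> in the triangle inequality for \<open>S x x y\<close> makes the first two terms vanish, leaving
  \<open>S y y x\<close>; the converse inequality follows by exchanging the points.\<close>

lemma sym:
  assumes "x \<in> X" "y \<in> X"
  shows "S x x y = S y y x"
proof (rule antisym)
  show "S x x y \<le> S y y x"
    using triangle[of x x y x] eq_zero_iff[of x x x] assms by simp
  show "S y y x \<le> S x x y"
    using triangle[of y y x y] eq_zero_iff[of y y y] assms by simp
qed

lemma displacement_pos:
  assumes "T \<in> X \<rightarrow> X" "x \<in> X" "T x \<noteq> x"
  shows "0 < S (T x) (T x) x"
proof -
  have "T x \<in> X" using assms by auto
  then show ?thesis
    using nonneg[of "T x" "T x" x] eq_zero_iff[of "T x" "T x" x] assms by simp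
qed

lemma displacement_inf_le:
  assumes "T \<in> X \<rightarrow> X" "x \<in> X" "T x \<noteq> x"
  shows "S_displacement_inf X S T \<le> S (T x) (T x) x"
  unfolding S_displacement_inf_def
proof (rule cInf_lower)
  show "bdd_below {S (T x) (T x) x |x. T x \<noteq> x \<and> x \<in> X}"
    using displacement_pos[OF assms(1)] by (intro bdd_belowI[of _ 0]) (auto intro: less_imp_le)
qed (use assms in blast)

text \<open>At \<open>x = x0\<close> the first alternative of the maximum is zero and the second is \<open>b\<close> times the
  displacement of \<open>x0\<close>, so the condition contradicts a positive displacement.\<close>

lemma Zamfirescu_centre_fixed:
  assumes T: "T \<in> X \<rightarrow> X" and x0: "x0 \<in> X" and Z: "S_Zamfirescu_type X S T x0"
  shows "T x0 = x0"
proof (rule ccontr)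
  assume "T x0 \<noteq> x0"
  then have pos: "0 < S (T x0) (T x0) x0"
    using displacement_pos T x0 by blast
  obtain a b :: real where "b < 1" and
    "S (T x0) (T x0) x0 \<le> max (a * S x0 x0 x0) (b / 2 * (S (T x0) (T x0) x0 + S (T x0) (T x0) x0))"
    using Z x0 pos unfolding S_Zamfirescu_type_def by fastforce
  moreover have "S x0 x0 x0 = 0"
    using eq_zero_iff x0 by simp
  ultimately have "S (T x0) (T x0) x0 \<le> b * S (T x0) (T x0) x0"
    using pos by (simp add: le_max_iff_disj)
  moreover have "b * S (T x0) (T x0) x0 < S (T x0) (T x0) x0"
    using \<open>b < 1\<close> pos by simp
  ultimately show False by simp
qed

text \<open>Assuming that \<open>x\<close> moves, \<open>r\<close> is at most its displacement \<open>d\<close>, so membership in the disc and the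
  bound on \<open>T x\<close> turn the two alternatives of the maximum into \<open>a * d\<close> and \<open>b * d\<close>, both smaller
  than \<open>d\<close>.\<close>

lemma Zamfirescu_fixed_in_disc:
  assumes T: "T \<in> X \<rightarrow> X" and x0: "x0 \<in> X" and Z: "S_Zamfirescu_type X S T x0"
    and x: "x \<in> S_disc X S x0 r"
    and r: "T x \<noteq> x \<Longrightarrow> r \<le> S (T x) (T x) x"
    and Tx: "S (T x) (T x) x0 \<le> r"
  shows "T x = x"
proof (rule ccontr)
  let ?d = "S (T x) (T x) x"
  assume moved: "T x \<noteq> x"
  have xX: "x \<in> X" and xr: "S x x x0 \<le> r"
    using x by (auto simp: S_disc_def)
  have pos: "0 < ?d" and r_le: "r \<le> ?d"
    using displacement_pos[OF T xX moved] r moved by auto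
  obtain a b where ab: "0 \<le> a" "a < 1" "0 \<le> b" "b < 1" and
    le: "?d \<le> max (a * S x x x0) (b / 2 * (S (T x0) (T x0) x + S (T x) (T x) x0))"
    using Z xX pos unfolding S_Zamfirescu_type_def by fastforce
  have "S (T x0) (T x0) x = S x x x0"
    using Zamfirescu_centre_fixed[OF T x0 Z] sym[OF x0 xX] by simp
  then have "S (T x0) (T x0) x + S (T x) (T x) x0 \<le> 2 * ?d"
    using xr Tx r_le by simp
  then have "b / 2 * (S (T x0) (T x0) x + S (T x) (T x) x0) \<le> b / 2 * (2 * ?d)"
    using ab by (intro mult_left_mono) auto
  also have "\<dots> < ?d"
    using ab pos by simp
  finally have "b / 2 * (S (T x0) (T x0) x + S (T x) (T x) x0) < ?d" .
  moreover have "a * S x x x0 < ?d"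
  proof -
    have "a * S x x x0 \<le> a * ?d"
      using xr r_le ab by (intro mult_left_mono) auto
    also have "\<dots> < ?d"
      using ab pos by simp
    finally show ?thesis .
  qed
  ultimately show False
    using le by simp
qed

end

theorem corollary3p3:
  fixes X :: "'a set" and S :: "'a \<Rightarrow> 'a \<Rightarrow> 'a \<Rightarrow> real" and T :: "'a \<Rightarrow> 'a"
    and x0 :: 'a and \<rho> :: real
  assumes "S_metric_space X S"
    and "T \<in> X \<rightarrow> X"
    and "\<rho> = S_displacement_inf X S T"
    and "x0 \<in> X"
    and "S_Zamfirescu_type X S T x0"
    and "\<And>x. x \<in> S_disc X S x0 \<rho> \<Longrightarrow> S (T x) (T x) x0 \<le> \<rho>"
  shows "fixed_disc X S T x0 \<rho> \<and> S_disc X S x0 \<rho> \<subseteq> Fix X T"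
proof -
  interpret S_metric_space X S by fact
  have "T x = x" if x: "x \<in> S_disc X S x0 \<rho>" for x
  proof (rule Zamfirescu_fixed_in_disc[OF assms(2,4,5) x])
    have "x \<in> X" using x by (simp add: S_disc_def)
    then show "\<rho> \<le> S (T x) (T x) x" if "T x \<noteq> x"
      using displacement_inf_le[OF assms(2) _ that] assms(3) by simp
    show "S (T x) (T x) x0 \<le> \<rho>"
      using assms(6) x .
  qed
  then show ?thesis
    by (auto simp: fixed_disc_def Fix_def S_disc_def)
qed

end
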